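(* Let $\mathbb{F}$ be any field and $M\in\mathbb{F}^{2\times 2}$. There is a constant $\varepsilon>0.01526$ such that, for every positive integer $n$, writing $N=2^n$, the matrix $M^{\otimes n}$ has a synchronous linear circuit over $\mathbb{F}$ of size at most $\big((1-\varepsilon)\cdot e\cdot\ln 2+o(1)\big)\cdot N\log_2 N$, where $o(1)\to0$ as $n\to\infty$. When $M=H_1=\begin{bmatrix}1&1\\1&-1\end{bmatrix}$ (so $M^{\otimes n}=H_n$, the Walsh–Hadamard transform) the same holds with some $\varepsilon>0.04816$.
   Context: Kronecker power $M^{\otimes n}$ as usual. A synchronous linear circuit (of any depth $d$) for a matrix $A$ is a factorization $A=A_1\times\cdots\times A_d$, whose size is $\sum_j\mathrm{nnz}(A_j)$, where $\mathrm{nnz}$ counts nonzero entries. *)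

theory Defs
  imports Complex_Main "Jordan_Normal_Form.Matrix"
begin

definition kron :: "'a::semiring_1 mat \<Rightarrow> 'a mat \<Rightarrow> 'a mat" where
  "kron A B = mat (dim_row A * dim_row B) (dim_col A * dim_col B)
     (\<lambda>(i,j). A $$ (i div dim_row B, j div dim_col B) * B $$ (i mod dim_row B, j mod dim_col B))"

fun kron_pow :: "'a::semiring_1 mat \<Rightarrow> nat \<Rightarrow> 'a mat" where
  "kron_pow M 0 = 1\<^sub>m 1"
| "kron_pow M (Suc n) = kron M (kron_pow M n)"

definition nnz :: "'a::zero mat \<Rightarrow> nat" where
  "nnz A = card {(i,j). i < dim_row A \<and> j < dim_col A \<and> A $$ (i,j) \<noteq> 0}"

definition sync_circuit :: "'a::semiring_1 mat \<Rightarrow> 'a mat list \<Rightarrow> bool" where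
  "sync_circuit A As \<longleftrightarrow> As \<noteq> [] \<and>
     dim_row (hd As) = dim_row A \<and> dim_col (last As) = dim_col A \<and>
     (\<forall>j. Suc j < length As \<longrightarrow> dim_col (As ! j) = dim_row (As ! Suc j)) \<and>
     foldr (*) As (1\<^sub>m (dim_col A)) = A"

definition circuit_size :: "'a::zero mat list \<Rightarrow> nat" where
  "circuit_size As = sum_list (map nnz As)"

definition H1 :: "'a::ring_1 mat" where
  "H1 = mat_of_rows_list 2 [[1, 1], [1, -1]]"

end

theory Submission
  imports Defs
begin

text \<open>Up to a permutation, \<open>M\<close> is a lower triangular matrix times an upper triangular one, so it
  suffices to treat \<open>L\<^sup>\<otimes>\<^sup>n\<close> for lower triangular \<open>L\<close>, a rescaled zeta transform over
  subsets of \<open>{1..n}\<close>; the upper factor follows by transposition. Each output of the zeta transform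
  needs work only at the positions that it contains. If different outputs work at different positions in
  the same layer, about \<open>n / 2\<close> layers of fan-in two suffice, which gives \<open>2 n 2\<^sup>n\<close> wires for \<open>M\<^sup>\<otimes>\<^sup>n\<close>.
  Grouping the positions in pairs saves more: an output containing both positions of a pair can be formed
  from three terms instead of four if the output containing only the first one is ready. With \<open>n / 2\<close>
  pairs this takes about \<open>n / 8 + n / 4\<close> layers and \<open>n / 2\<close> additional wires per output, that is
  \<open>1.75 n 2\<^sup>n\<close> wires for both triangular factors. By a Chernoff bound few outputs need more layers than
  that, and they finish in large batches. The total beats
  \<open>(1 - 0.0482) e ln 2 n 2\<^sup>n\<close>.\<close>

section \<open>Sparsity of block matrices and Kronecker products\<close>

definition row_nnz :: "'a::zero mat \<Rightarrow> nat \<Rightarrow> nat" where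
  "row_nnz A i = card {j. j < dim_col A \<and> A $$ (i,j) \<noteq> 0}"

lemma nnz_eq_sum_row_nnz: "nnz A = (\<Sum>i<dim_row A. row_nnz A i)"
proof -
  have "{(i,j). i < dim_row A \<and> j < dim_col A \<and> A $$ (i,j) \<noteq> 0}
      = Sigma {..<dim_row A} (\<lambda>i. {j. j < dim_col A \<and> A $$ (i,j) \<noteq> 0})"
    by auto
  then show ?thesis
    unfolding nnz_def row_nnz_def by (simp add: card_SigmaI)
qed

lemma row_nnz_one: "i < n \<Longrightarrow> row_nnz (1\<^sub>m n :: 'a::zero_neq_one mat) i = 1"
proof -
  assume i: "i < n"
  then have "{j. j < n \<and> 1\<^sub>m n $$ (i,j) \<noteq> (0::'a)} = {i}" by (auto split: if_splits)
  then show ?thesis by (simp add: row_nnz_def)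
qed

lemma nnz_one: "nnz (1\<^sub>m n :: 'a::zero_neq_one mat) = n"
  by (simp add: nnz_eq_sum_row_nnz row_nnz_one)

lemma nnz_transpose: "nnz (transpose_mat A) = nnz A"
proof -
  have "bij_betw prod.swap
      {(i,j). i < dim_row A \<and> j < dim_col A \<and> A $$ (i,j) \<noteq> 0}
      {(i,j). i < dim_col A \<and> j < dim_row A \<and> transpose_mat A $$ (i,j) \<noteq> 0}"
    by (rule bij_betwI[where g = prod.swap]) auto
  then show ?thesis
    unfolding nnz_def by (simp add: bij_betw_same_card)
qed

lemma sum_div_mod:
  "(\<Sum>l<p * m. f (l div m) (l mod m)) = (\<Sum>c<p. \<Sum>u<m. f c u)" for m :: nat
proof -
  have "(\<Sum>l<p * m. f (l div m) (l mod m))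
      = (\<Sum>c<p. \<Sum>l = c * m..<c * m + m. f (l div m) (l mod m))"
    by (rule sum.nat_group[symmetric])
  also have "\<dots> = (\<Sum>c<p. \<Sum>u<m. f c u)"
  proof (rule sum.cong[OF refl])
    fix c
    have "(\<Sum>l = c * m..<c * m + m. f (l div m) (l mod m))
        = (\<Sum>u = 0..<m. f ((u + c * m) div m) ((u + c * m) mod m))"
      using sum.shift_bounds_nat_ivl[of "\<lambda>l. f (l div m) (l mod m)" 0 "c * m" m]
      by (simp add: add.commute)
    also have "\<dots> = (\<Sum>u<m. f c u)"
      by (rule sum.cong) auto
    finally show "(\<Sum>l = c * m..<c * m + m. f (l div m) (l mod m)) = (\<Sum>u<m. f c u)" .
  qed
  finally show ?thesis .
qed

text \<open>A Kronecker product whose right factor may vary with the block row: block row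
  \<open>a\<close> is row \<open>a\<close> of \<open>C\<close> tensored with \<open>G a\<close>. A
  constant \<open>G\<close> gives \<open>kron C G\<close>.\<close>

definition block_rows :: "'a::semiring_1 mat \<Rightarrow> nat \<Rightarrow> (nat \<Rightarrow> 'a mat) \<Rightarrow> 'a mat" where
  "block_rows C m G = mat (dim_row C * m) (dim_col C * m)
     (\<lambda>(i,j). C $$ (i div m, j div m) * G (i div m) $$ (i mod m, j mod m))"

lemma block_rows_dim [simp]:
  "dim_row (block_rows C m G) = dim_row C * m" "dim_col (block_rows C m G) = dim_col C * m"
  by (simp_all add: block_rows_def)

lemma div_mod_less:
  assumes "i < p * m" shows "i div m < p" "i mod m < (m::nat)"
proof -
  have "m > 0" using assms by (cases m) auto
  then show "i div m < p" "i mod m < m"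
    using assms by (simp_all add: less_mult_imp_div_less)
qed

lemma kron_eq_block_rows:
  assumes "G \<in> carrier_mat m m" shows "kron C G = block_rows C m (\<lambda>_. G)"
  using assms by (auto simp: kron_def block_rows_def)

text \<open>Block \<open>(a,b)\<close> of the product sums \<open>C $$ (a,c) * C' $$ (c,b)\<close>
  times \<open>G a * H c\<close> over \<open>c\<close>. The matrix part comes out of the sum because
  \<open>H c\<close> is the same matrix \<open>K a\<close> for every \<open>c\<close> that row
  \<open>a\<close> of \<open>C\<close> reaches.\<close>

lemma block_rows_mult:
  fixes C C' :: "'a::comm_semiring_1 mat"
  assumes C: "C \<in> carrier_mat p q" and C': "C' \<in> carrier_mat q r"
    and G: "\<And>a. a < p \<Longrightarrow> G a \<in> carrier_mat m m"
    and K: "\<And>a. a < p \<Longrightarrow> K a \<in> carrier_mat m m"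
    and HK: "\<And>a c. a < p \<Longrightarrow> c < q \<Longrightarrow> C $$ (a,c) \<noteq> 0 \<Longrightarrow> H c = K a"
  shows "block_rows C m G * block_rows C' m H = block_rows (C * C') m (\<lambda>a. G a * K a)"
proof (rule eq_matI)
  fix i j
  assume "i < dim_row (block_rows (C * C') m (\<lambda>a. G a * K a))"
    and "j < dim_col (block_rows (C * C') m (\<lambda>a. G a * K a))"
  then have i: "i < p * m" and j: "j < r * m" using C C' by auto
  define a s b t where "a = i div m" and "s = i mod m" and "b = j div m" and "t = j mod m"
  note d = div_mod_less[OF i, folded a_def s_def] div_mod_less[OF j, folded b_def t_def]
  have "(block_rows C m G * block_rows C' m H) $$ (i,j)
      = (\<Sum>l<q * m. block_rows C m G $$ (i,l) * block_rows C' m H $$ (l,j))"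
    using C C' i j by (simp add: scalar_prod_def lessThan_atLeast0)
  also have "\<dots> = (\<Sum>l<q * m. (\<lambda>c u. (C $$ (a,c) * G a $$ (s,u)) * (C' $$ (c,b) * H c $$ (u,t)))
                      (l div m) (l mod m))"
    using C C' i j by (intro sum.cong) (auto simp: block_rows_def a_def s_def b_def t_def)
  also have "\<dots> = (\<Sum>c<q. \<Sum>u<m. (C $$ (a,c) * G a $$ (s,u)) * (C' $$ (c,b) * H c $$ (u,t)))"
    by (rule sum_div_mod)
  also have "\<dots> = (\<Sum>c<q. \<Sum>u<m. (C $$ (a,c) * C' $$ (c,b)) * (G a $$ (s,u) * K a $$ (u,t)))"
  proof (intro sum.cong refl)
    fix c u assume "c \<in> {..<q}"
    then show "(C $$ (a,c) * G a $$ (s,u)) * (C' $$ (c,b) * H c $$ (u,t))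
        = (C $$ (a,c) * C' $$ (c,b)) * (G a $$ (s,u) * K a $$ (u,t))"
      using HK[of a c] d by (cases "C $$ (a,c) = 0") (auto simp: ac_simps)
  qed
  also have "\<dots> = (C * C') $$ (a,b) * (G a * K a) $$ (s,t)"
    using C C' G[OF d(1)] K[OF d(1)] d
    by (simp add: scalar_prod_def lessThan_atLeast0 sum_product)
  also have "\<dots> = block_rows (C * C') m (\<lambda>a. G a * K a) $$ (i,j)"
    using C C' i j by (simp add: block_rows_def a_def s_def b_def t_def)
  finally show "(block_rows C m G * block_rows C' m H) $$ (i,j)
      = block_rows (C * C') m (\<lambda>a. G a * K a) $$ (i,j)" .
qed (use C C' in auto)

text \<open>A nonzero entry needs both factors nonzero, and a column is determined by its block and
  its offset. Zero divisors can make the inequality strict.\<close>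

lemma row_nnz_block_rows_le:
  assumes "i < dim_row C * m" and "G (i div m) \<in> carrier_mat m m"
  shows "row_nnz (block_rows C m G) i \<le> row_nnz C (i div m) * row_nnz (G (i div m)) (i mod m)"
proof -
  let ?S = "{b. b < dim_col C \<and> C $$ (i div m, b) \<noteq> 0}"
  let ?T = "{t. t < dim_col (G (i div m)) \<and> G (i div m) $$ (i mod m, t) \<noteq> 0}"
  have "card {j. j < dim_col C * m \<and> block_rows C m G $$ (i,j) \<noteq> 0} \<le> card (?S \<times> ?T)"
  proof (rule card_inj_on_le[where f = "\<lambda>j. (j div m, j mod m)"])
    show "inj_on (\<lambda>j. (j div m, j mod m)) {j. j < dim_col C * m \<and> block_rows C m G $$ (i,j) \<noteq> 0}"
      by (rule inj_onI) (metis div_mult_mod_eq prod.inject)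
    show "(\<lambda>j. (j div m, j mod m)) ` {j. j < dim_col C * m \<and> block_rows C m G $$ (i,j) \<noteq> 0}
        \<subseteq> ?S \<times> ?T"
      using assms by (auto simp: block_rows_def div_mod_less)
  qed simp
  then show ?thesis by (simp add: row_nnz_def card_cartesian_product)
qed

lemma nnz_block_rows_le:
  assumes "\<And>a. a < dim_row C \<Longrightarrow> G a \<in> carrier_mat m m"
  shows "nnz (block_rows C m G) \<le> (\<Sum>a<dim_row C. row_nnz C a * nnz (G a))"
proof -
  have "nnz (block_rows C m G)
      \<le> (\<Sum>i<dim_row C * m. (\<lambda>a s. row_nnz C a * row_nnz (G a) s) (i div m) (i mod m))"
    unfolding nnz_eq_sum_row_nnz block_rows_dim
    by (intro sum_mono row_nnz_block_rows_le) (auto simp: assms div_mod_less)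
  also have "\<dots> = (\<Sum>a<dim_row C. \<Sum>s<m. row_nnz C a * row_nnz (G a) s)"
    by (rule sum_div_mod)
  also have "\<dots> = (\<Sum>a<dim_row C. row_nnz C a * nnz (G a))"
    using carrier_matD(1)[OF assms] by (intro sum.cong refl)
      (simp add: nnz_eq_sum_row_nnz sum_distrib_left)
  finally show ?thesis .
qed

section \<open>Algebra of Kronecker products and powers\<close>

lemma kron_carrier:
  "A \<in> carrier_mat p q \<Longrightarrow> G \<in> carrier_mat m n \<Longrightarrow> kron A G \<in> carrier_mat (p * m) (q * n)"
  by (auto simp: kron_def)

lemma nnz_kron_le:
  assumes "G \<in> carrier_mat m m" shows "nnz (kron C G) \<le> nnz C * nnz G"
  using nnz_block_rows_le[of C "\<lambda>_. G" m] assms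
  by (simp add: kron_eq_block_rows nnz_eq_sum_row_nnz[of C] sum_distrib_right)

text \<open>The mixed-product rule, as the case of equal blocks in
  \<open>block_rows_mult\<close>.\<close>

lemma kron_mult_kron:
  fixes A B :: "'a::comm_semiring_1 mat"
  assumes "A \<in> carrier_mat p q" "B \<in> carrier_mat q r" "G \<in> carrier_mat m m" "H \<in> carrier_mat m m"
  shows "kron A G * kron B H = kron (A * B) (G * H)"
proof -
  have "G * H \<in> carrier_mat m m" using assms by simp
  then show ?thesis
    using block_rows_mult[OF assms(1,2), of "\<lambda>_. G" m "\<lambda>_. H" "\<lambda>_. H"] assms
    by (simp add: kron_eq_block_rows[of _ m])
qed

lemma transpose_kron: "transpose_mat (kron A G) = kron (transpose_mat A) (transpose_mat G)"
  by (rule eq_matI) (auto simp: kron_def div_mod_less)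

lemma kron_assoc: "kron (kron A B) C = kron A (kron B C)" for A B C :: "'a::semiring_1 mat"
proof (rule eq_matI)
  fix i j assume "i < dim_row (kron A (kron B C))" "j < dim_col (kron A (kron B C))"
  then have i: "i < dim_row A * dim_row B * dim_row C" "i < dim_row A * (dim_row B * dim_row C)"
    and j: "j < dim_col A * dim_col B * dim_col C" "j < dim_col A * (dim_col B * dim_col C)"
    by (auto simp: kron_def mult.assoc)
  have 1: "x div m div p = x div (p * m)" for x m p :: nat
    by (metis div_mult2_eq mult.commute)
  have 2: "x mod (p * m) div m = x div m mod p" for x m p :: nat
    using mod_mult2_eq[of x m p] by (cases "m = 0") (auto simp: mult.commute)
  have 3: "x mod (p * m) mod m = x mod m" for x m p :: nat
    by (simp add: mod_mod_cancel)
  show "kron (kron A B) C $$ (i,j) = kron A (kron B C) $$ (i,j)"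
    using i j
    by (simp add: kron_def div_mod_less mult.assoc 1 2 3)
qed (auto simp: kron_def)

lemma kron_pow_carrier: "M \<in> carrier_mat q q \<Longrightarrow> kron_pow M n \<in> carrier_mat (q ^ n) (q ^ n)"
  by (induction n) (auto intro: kron_carrier)

lemma nnz_kron_pow_le:
  "M \<in> carrier_mat q q \<Longrightarrow> nnz (kron_pow M n) \<le> nnz M ^ n"
proof (induction n)
  case (Suc n)
  have "nnz (kron M (kron_pow M n)) \<le> nnz M * nnz (kron_pow M n)"
    using kron_pow_carrier[OF Suc.prems] by (rule nnz_kron_le)
  also have "\<dots> \<le> nnz M * nnz M ^ n" using Suc by simp
  finally show ?case by simp
qed (simp add: nnz_one)

lemma kron_pow_mult:
  fixes A B :: "'a::comm_semiring_1 mat"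
  assumes "A \<in> carrier_mat q q" "B \<in> carrier_mat q q"
  shows "kron_pow (A * B) n = kron_pow A n * kron_pow B n"
proof (induction n)
  case (Suc n)
  then show ?case
    using kron_mult_kron[OF assms kron_pow_carrier[OF assms(1)] kron_pow_carrier[OF assms(2)], of n]
    by simp
qed simp

lemma transpose_kron_pow: "transpose_mat (kron_pow M n) = kron_pow (transpose_mat M) n"
  by (induction n) (auto simp: transpose_kron)

text \<open>Groups the positions in pairs: two binary letters become one letter of a four-letter
  alphabet.\<close>

lemma kron_pow_double: "kron_pow M (2 * n) = kron_pow (kron M M) n"
  by (induction n) (auto simp: kron_assoc)

section \<open>Circuits with square layers\<close>

text \<open>Circuits all of whose layers are square of one fixed size; this is what makes transposes and
  Kronecker products with an identity immediate.\<close>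

inductive has_circuit :: "nat \<Rightarrow> 'a::semiring_1 mat \<Rightarrow> nat \<Rightarrow> bool" for N where
  layer: "A \<in> carrier_mat N N \<Longrightarrow> has_circuit N A (nnz A)"
| mult: "has_circuit N A s \<Longrightarrow> has_circuit N B t \<Longrightarrow> has_circuit N (A * B) (s + t)"

lemma has_circuit_carrier: "has_circuit N A s \<Longrightarrow> A \<in> carrier_mat N N"
  by (induction rule: has_circuit.induct) auto

text \<open>Transposing reverses the order of the layers and keeps the count of each. Upper
  triangular factors get their bounds this way.\<close>

lemma has_circuit_transpose:
  "has_circuit N A s \<Longrightarrow> has_circuit N (transpose_mat A) s" for A :: "'a::comm_semiring_1 mat"
proof (induction rule: has_circuit.induct)
  case (layer A)
  then show ?case
    using has_circuit.layer[of "transpose_mat A" N] by (simp add: nnz_transpose)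
next
  case (mult A s B t)
  then show ?case
    using has_circuit.mult[OF mult.IH(2,1)] transpose_mult[of A N N B N]
    by (simp add: has_circuit_carrier add.commute)
qed

text \<open>Runs \<open>p\<close> copies of a circuit side by side, layer by layer.\<close>

lemma has_circuit_kron_one:
  fixes A :: "'a::comm_semiring_1 mat"
  assumes "has_circuit N A s"
  obtains t where "has_circuit (p * N) (kron (1\<^sub>m p) A) t" "t \<le> p * s"
proof -
  from assms have "\<exists>t \<le> p * s. has_circuit (p * N) (kron (1\<^sub>m p) A) t"
  proof (induction rule: has_circuit.induct)
    case (layer A)
    then show ?case
      using has_circuit.layer[OF kron_carrier[OF one_carrier_mat layer]] nnz_kron_le[OF layer, of "1\<^sub>m p"]
      by (auto simp: nnz_one)
  next
    case (mult A s B t)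
    then obtain s' t' where "s' \<le> p * s" "has_circuit (p * N) (kron (1\<^sub>m p) A) s'"
      "t' \<le> p * t" "has_circuit (p * N) (kron (1\<^sub>m p) B) t'" by blast
    then show ?case
      using has_circuit.mult[of "p * N" "kron (1\<^sub>m p) A" s' "kron (1\<^sub>m p) B" t']
        kron_mult_kron[of "1\<^sub>m p" p p "1\<^sub>m p" p A N B] mult.hyps[THEN has_circuit_carrier]
      by (intro exI[of _ "s' + t'"]) (auto simp: distrib_left)
  qed
  then show ?thesis using that by blast
qed

lemma has_circuit_imp_sync_circuit:
  assumes "has_circuit N A s"
  obtains As where "sync_circuit A As" "circuit_size As = s"
proof -
  \<comment> \<open>The fold is claimed for every start value \<open>X\<close>: in
    \<open>As @ Bs\<close> the fold over \<open>As\<close> starts from \<open>B * X\<close>, so a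
    claim about the identity alone would not pass the induction.\<close>
  from assms have "\<exists>As. As \<noteq> [] \<and> (\<forall>X \<in> set As. X \<in> carrier_mat N N) \<and> circuit_size As = s \<and>
      (\<forall>X \<in> carrier_mat N N. foldr (*) As X = A * X)"
  proof (induction rule: has_circuit.induct)
    case (layer A)
    then show ?case by (intro exI[of _ "[A]"]) (simp add: circuit_size_def)
  next
    case (mult A s B t)
    then obtain As Bs where As: "As \<noteq> []" "\<forall>X \<in> set As. X \<in> carrier_mat N N" "circuit_size As = s"
        "\<forall>X \<in> carrier_mat N N. foldr (*) As X = A * X"
      and Bs: "Bs \<noteq> []" "\<forall>X \<in> set Bs. X \<in> carrier_mat N N" "circuit_size Bs = t"
        "\<forall>X \<in> carrier_mat N N. foldr (*) Bs X = B * X" by blast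
    have "A \<in> carrier_mat N N" "B \<in> carrier_mat N N"
      using mult.hyps by (auto dest: has_circuit_carrier)
    with As Bs show ?case
      by (intro exI[of _ "As @ Bs"]) (auto simp: circuit_size_def assoc_mult_mat[of _ N N _ N _ N])
  qed
  then obtain As where As: "As \<noteq> []" "\<forall>X \<in> set As. X \<in> carrier_mat N N" "circuit_size As = s"
    "\<forall>X \<in> carrier_mat N N. foldr (*) As X = A * X" by blast
  have A: "A \<in> carrier_mat N N" using assms by (rule has_circuit_carrier)
  have dims: "dim_row X = N" "dim_col X = N" if "X \<in> set As" for X
    using As(2) that by auto
  have "sync_circuit A As"
    unfolding sync_circuit_def using A As by (auto simp: dims)
  then show ?thesis using that As(3) by blast
qed

text \<open>A row index of \<open>B\<^sup>\<otimes>\<^sup>n\<close> is a word in the row indices of \<open>B\<close>; the letters in \<open>S\<close> stand for the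
  rows of \<open>B\<close> with more than one nonzero entry. In the row of such a word, \<open>partial_pow B S n t k\<close> applies
  \<open>B\<close> at the positions after the \<open>t\<close>-th letter from \<open>S\<close> up to and including the \<open>(t + k)\<close>-th, so
  different rows work at different positions in the same layer and none idles before its work is done.\<close>

fun partial_pow :: "'a::semiring_1 mat \<Rightarrow> nat set \<Rightarrow> nat \<Rightarrow> nat \<Rightarrow> nat \<Rightarrow> 'a mat" where
  "partial_pow B S 0 t k = 1\<^sub>m 1"
| "partial_pow B S (Suc n) t k =
     block_rows (if t = 0 \<and> k > 0 then B else 1\<^sub>m (dim_row B)) (dim_row B ^ n)
       (\<lambda>a. if a \<in> S then partial_pow B S n (t - 1) (if t = 0 then k - 1 else k)
            else partial_pow B S n t k)"

section \<open>Composition of partial powers, and the circuits they form\<close>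

context
  fixes B :: "'a::comm_semiring_1 mat" and q :: nat and S :: "nat set"
  assumes B: "B \<in> carrier_mat q q"
begin

lemma dim_row_B [simp]: "dim_row B = q" and dim_col_B [simp]: "dim_col B = q"
  using B by auto

lemma partial_pow_carrier: "partial_pow B S n t k \<in> carrier_mat (q ^ n) (q ^ n)"
  by (cases n) auto

lemma block_rows_one: "block_rows (1\<^sub>m p) m (\<lambda>_. 1\<^sub>m m) = (1\<^sub>m (p * m) :: 'a mat)"
proof (rule eq_matI)
  fix i j assume "i < dim_row (1\<^sub>m (p * m) :: 'a mat)" "j < dim_col (1\<^sub>m (p * m) :: 'a mat)"
  moreover have "i = j \<longleftrightarrow> i div m = j div m \<and> i mod m = j mod m" by (metis div_mult_mod_eq)
  ultimately show "block_rows (1\<^sub>m p) m (\<lambda>_. 1\<^sub>m m) $$ (i,j) = (1\<^sub>m (p * m) :: 'a mat) $$ (i,j)"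
    by (auto simp: block_rows_def div_mod_less)
qed auto

lemma partial_pow_zero: "partial_pow B S n t 0 = 1\<^sub>m (q ^ n)"
proof (induction n arbitrary: t)
  case (Suc n)
  then show ?case by (simp add: block_rows_one cong: if_cong)
qed simp

text \<open>A word of length \<open>n\<close> has at most \<open>n\<close> letters from
  \<open>S\<close>, so for \<open>k \<ge> n\<close> the window never closes.\<close>

lemma partial_pow_all: "n \<le> k \<Longrightarrow> partial_pow B S n 0 k = kron_pow B n"
proof (induction n arbitrary: k)
  case (Suc n)
  then show ?case
    using kron_eq_block_rows[OF kron_pow_carrier[OF B]] by (simp cong: if_cong)
qed simp

text \<open>As long as the right factor is at work, the left one is an identity on the letters, so
  the intermediate word agrees there with the row word. Both factors therefore count the same
  letters from \<open>S\<close>, and the two windows join without gap or overlap.\<close>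

lemma partial_pow_mult:
  "partial_pow B S n t k * partial_pow B S n 0 t = partial_pow B S n 0 (t + k)"
proof (induction n arbitrary: t k)
  case (Suc n)
  show ?case
  proof (cases "t = 0")
    case True
    then show ?thesis
      using partial_pow_carrier[of "Suc n" 0 k] by (simp only: partial_pow_zero) simp
  next
    case False
    let ?H = "\<lambda>a. if a \<in> S then partial_pow B S n 0 (t - 1) else partial_pow B S n 0 t"
    let ?G = "\<lambda>a. if a \<in> S then partial_pow B S n (t - 1) k else partial_pow B S n t k"
    have "block_rows (1\<^sub>m q) (q ^ n) ?G * block_rows B (q ^ n) ?H
        = block_rows (1\<^sub>m q * B) (q ^ n) (\<lambda>a. ?G a * ?H a)"
      by (rule block_rows_mult[where K = ?H, OF one_carrier_mat B])
         (auto simp: partial_pow_carrier split: if_splits)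
    also have "\<dots> = block_rows B (q ^ n)
        (\<lambda>a. if a \<in> S then partial_pow B S n 0 (t + k - 1) else partial_pow B S n 0 (t + k))"
      using False B by (intro arg_cong2[where f = "\<lambda>C. block_rows C (q ^ n)"])
        (auto simp: Suc fun_eq_iff)
    finally show ?thesis using False by (simp cong: if_cong)
  qed
qed simp


text \<open>Layer \<open>t\<close> carries each row up to its \<open>(t + 1)\<close>-th letter from
  \<open>S\<close>. The leading \<open>q ^ n\<close> pays for an identity layer, since a circuit has
  at least one layer.\<close>

lemma has_circuit_single_steps:
  "\<exists>s \<le> q ^ n + (\<Sum>t<m. nnz (partial_pow B S n t 1)).
     has_circuit (q ^ n) (partial_pow B S n 0 m) s"
proof (induction m)
  case 0
  then show ?case
    using has_circuit.layer[OF one_carrier_mat] by (auto simp: partial_pow_zero nnz_one)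
next
  case (Suc m)
  then obtain s where "s \<le> q ^ n + (\<Sum>t<m. nnz (partial_pow B S n t 1))"
    "has_circuit (q ^ n) (partial_pow B S n 0 m) s" by blast
  then show ?case
    using has_circuit.mult[OF has_circuit.layer[OF partial_pow_carrier[of n m 1]]]
    by (intro exI[of _ "nnz (partial_pow B S n m 1) + s"])
       (auto simp: partial_pow_mult[of n m 1, simplified, symmetric])
qed

text \<open>The finishing phase: each layer passes \<open>r\<close> letters from \<open>S\<close> at
  once. Fan-in may then grow up to exponentially in \<open>r\<close>, which is cheap once few rows
  have such letters left.\<close>

lemma has_circuit_batches:
  assumes "has_circuit (q ^ n) (partial_pow B S n 0 m) s"
    and c: "\<And>t. t \<ge> m \<Longrightarrow> real (nnz (partial_pow B S n t r)) \<le> c"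
  shows "\<exists>s'. real s' \<le> s + j * c \<and> has_circuit (q ^ n) (partial_pow B S n 0 (m + j * r)) s'"
proof (induction j)
  case 0
  then show ?case using assms(1) by auto
next
  case (Suc j)
  then obtain s' where s': "real s' \<le> s + j * c"
    "has_circuit (q ^ n) (partial_pow B S n 0 (m + j * r)) s'" by blast
  have "partial_pow B S n 0 (m + Suc j * r)
      = partial_pow B S n (m + j * r) r * partial_pow B S n 0 (m + j * r)"
    by (simp add: partial_pow_mult algebra_simps)
  then show ?case
    using has_circuit.mult[OF has_circuit.layer[OF partial_pow_carrier[of n "m + j * r" r]] s'(2)]
      s'(1) c[of "m + j * r"]
    by (intro exI[of _ "nnz (partial_pow B S n (m + j * r) r) + s'"]) (auto simp: algebra_simps)
qed

section \<open>Wire counts of the layers\<close>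

context
  fixes e :: "nat \<Rightarrow> nat" and w :: nat
  assumes S: "S \<subseteq> {..<q}"
    and light: "\<And>a. a < q \<Longrightarrow> a \<notin> S \<Longrightarrow> row_nnz B a \<le> 1"
    and heavy: "\<And>a. a \<in> S \<Longrightarrow> row_nnz B a \<le> Suc (e a)"
    and w: "\<And>a. a \<in> S \<Longrightarrow> e a < w" "w \<ge> 1"
begin

lemma sum_if_S:
  "(\<Sum>a<q. if a \<in> S then f a else c) = sum f S + (real q - real (card S)) * c" for c :: real
proof -
  have "finite S" using S finite_subset by blast
  have "card ({..<q} - S) = q - card S" "card S \<le> q"
    using S \<open>finite S\<close> card_mono[OF _ S] by (simp_all add: card_Diff_subset)
  moreover have "{..<q} \<inter> S = S" "{..<q} \<inter> - S = {..<q} - S" using S by auto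
  ultimately show ?thesis
    using sum.If_cases[of "{..<q}" "\<lambda>a. a \<in> S" f "\<lambda>_. c"] by (simp add: of_nat_diff)
qed

text \<open>Splits the rows by first letter. A letter outside \<open>S\<close> costs a factor of at
  most one whether or not \<open>B\<close> acts on it. A letter \<open>a\<close> from
  \<open>S\<close> costs \<open>Suc (e a)\<close> only inside the window, and then uses up one unit
  of \<open>k\<close>.\<close>

lemma nnz_partial_pow_Suc:
  "nnz (partial_pow B S (Suc n) t k) \<le>
     (\<Sum>a<q. if a \<in> S then if t = 0 \<and> k > 0 then Suc (e a) * nnz (partial_pow B S n 0 (k - 1))
                              else nnz (partial_pow B S n (t - 1) k)
           else nnz (partial_pow B S n t k))"
proof -
  let ?C = "if t = 0 \<and> k > 0 then B else 1\<^sub>m q"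
  let ?G = "\<lambda>a. if a \<in> S then partial_pow B S n (t - 1) (if t = 0 then k - 1 else k)
            else partial_pow B S n t k"
  have "nnz (block_rows ?C (q ^ n) ?G) \<le> (\<Sum>a<dim_row ?C. row_nnz ?C a * nnz (?G a))"
    by (rule nnz_block_rows_le) (auto simp: partial_pow_carrier)
  also have "\<dots> = (\<Sum>a<q. row_nnz ?C a * nnz (?G a))" by simp
  also have "\<dots> \<le> (\<Sum>a<q. if a \<in> S then
                              if t = 0 \<and> k > 0 then Suc (e a) * nnz (partial_pow B S n 0 (k - 1))
                              else nnz (partial_pow B S n (t - 1) k)
           else nnz (partial_pow B S n t k))"
  proof (rule sum_mono)
    fix a assume "a \<in> {..<q}"
    then have a: "a < q" by simp
    show "row_nnz ?C a * nnz (?G a) \<le>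
       (if a \<in> S then if t = 0 \<and> k > 0 then Suc (e a) * nnz (partial_pow B S n 0 (k - 1))
                              else nnz (partial_pow B S n (t - 1) k)
           else nnz (partial_pow B S n t k))"
    proof (cases "t = 0 \<and> k > 0")
      case True
      then show ?thesis
        using light[OF a] heavy[of a] mult_le_mono1[of "row_nnz B a" _ "nnz (?G a)"] by fastforce
    next
      case False
      then show ?thesis using a by (auto simp: row_nnz_one)
    qed
  qed
  finally show ?thesis by (simp only: partial_pow.simps dim_row_B)
qed

text \<open>A window holds at most \<open>k\<close> letters from \<open>S\<close>, and each
  multiplies the wires by at most \<open>w\<close>.\<close>

lemma nnz_partial_pow_le: "nnz (partial_pow B S n t k) \<le> w ^ k * q ^ n"
proof (induction n arbitrary: t k)
  case (Suc n)
  have "nnz (partial_pow B S (Suc n) t k) \<le> (\<Sum>a<q. w ^ k * q ^ n)"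
  proof (rule order_trans[OF nnz_partial_pow_Suc sum_mono])
    fix a
    show "(if a \<in> S then if t = 0 \<and> k > 0 then Suc (e a) * nnz (partial_pow B S n 0 (k - 1))
                              else nnz (partial_pow B S n (t - 1) k)
           else nnz (partial_pow B S n t k)) \<le> w ^ k * q ^ n"
    proof (cases "a \<in> S \<and> t = 0 \<and> k > 0")
      case True
      then have "Suc (e a) * nnz (partial_pow B S n 0 (k - 1)) \<le> w * (w ^ (k - 1) * q ^ n)"
        using w(1) Suc.IH by (intro mult_le_mono) (auto intro: Suc_leI)
      also have "\<dots> = w ^ k * q ^ n"
        using True by (simp add: power_eq_if mult.assoc)
      finally show ?thesis using True by simp
    qed (auto simp: Suc.IH)
  qed
  then show ?case by (simp add: ac_simps)
qed (use w in \<open>simp add: nnz_one\<close>)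

text \<open>Each of the \<open>m\<close> layers costs one wire per row. Beyond that, a letter
  \<open>a\<close> from \<open>S\<close> costs \<open>e a\<close> wires in at most one layer, and
  over all words the average sum of \<open>e\<close> over the letters from \<open>S\<close> is
  \<open>n * (\<Sum>a\<in>S. e a) / q\<close>.\<close>

lemma sum_nnz_partial_pow_le:
  assumes "q > 0"
  shows "(\<Sum>t<m. real (nnz (partial_pow B S n t 1))) \<le> q ^ n * (m + n * (\<Sum>a\<in>S. e a) / q)"
proof (induction n arbitrary: m)
  case 0
  then show ?case by (simp add: nnz_one)
next
  case (Suc n)
  let ?W = "real (\<Sum>a\<in>S. e a)"
  let ?f = "\<lambda>a t. if t = 0 then Suc (e a) * real (q ^ n) else real (nnz (partial_pow B S n (t - 1) 1))"
  \<comment> \<open>For a word starting with \<open>a\<close> from \<open>S\<close>, layer 0 handles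
    that letter and the remaining layers are those of the shorter word, shifted by one.\<close>
  have *: "(\<Sum>t<m. ?f a t) \<le> q ^ n * (m + n * ?W / q) + q ^ n * e a" for a
  proof (cases m)
    case (Suc m')
    have "(\<Sum>t<m. ?f a t) = Suc (e a) * real (q ^ n) + (\<Sum>t<m'. real (nnz (partial_pow B S n t 1)))"
      by (simp only: Suc sum.lessThan_Suc_shift) simp
    also have "\<dots> \<le> Suc (e a) * real (q ^ n) + q ^ n * (m' + n * ?W / q)"
      using Suc.IH[of m'] by simp
    finally show ?thesis by (simp add: Suc algebra_simps)
  qed (simp add: sum_nonneg)
  have "(\<Sum>t<m. real (nnz (partial_pow B S (Suc n) t 1)))
      \<le> (\<Sum>t<m. \<Sum>a<q. if a \<in> S then ?f a t else real (nnz (partial_pow B S n t 1)))"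
  proof (rule sum_mono)
    fix t
    have "real (nnz (partial_pow B S (Suc n) t 1)) \<le> real (\<Sum>a<q. if a \<in> S then
              if t = 0 \<and> 1 > (0::nat) then Suc (e a) * nnz (partial_pow B S n 0 (1 - 1))
              else nnz (partial_pow B S n (t - 1) 1) else nnz (partial_pow B S n t 1))"
      using nnz_partial_pow_Suc[of n t 1] by (simp only: of_nat_le_iff)
    also have "\<dots> = (\<Sum>a<q. if a \<in> S then ?f a t else real (nnz (partial_pow B S n t 1)))"
      unfolding of_nat_sum by (intro sum.cong refl) (simp add: partial_pow_zero nnz_one distrib_right)
    finally show "real (nnz (partial_pow B S (Suc n) t 1))
      \<le> (\<Sum>a<q. if a \<in> S then ?f a t else real (nnz (partial_pow B S n t 1)))" .
  qed
  also have "\<dots> = (\<Sum>a<q. \<Sum>t<m. if a \<in> S then ?f a t else real (nnz (partial_pow B S n t 1)))"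
    by (rule sum.swap)
  also have "\<dots> \<le> (\<Sum>a<q. q ^ n * (m + n * ?W / q) + (if a \<in> S then real (q ^ n * e a) else 0))"
    by (rule sum_mono) (use * Suc.IH in auto)
  also have "\<dots> = q * (q ^ n * (m + n * ?W / q)) + q ^ n * ?W"
    using sum_if_S[of "\<lambda>a. real (q ^ n * e a)" 0] by (simp add: sum.distrib sum_distrib_left)
  also have "\<dots> = q ^ Suc n * (m + Suc n * (\<Sum>a\<in>S. e a) / q)"
    using assms by (simp add: field_simps)
  finally show ?case .
qed

text \<open>An exponential Markov bound: \<open>(q - card S + card S * \<theta>) ^ n\<close> is the sum of \<open>\<theta>\<close> to the number of
  letters in \<open>S\<close> over all row indices, and rows with at most \<open>t\<close> such letters cost one wire.\<close>

lemma nnz_partial_pow_tail_le: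
  fixes \<theta> \<sigma> :: real
  assumes \<theta>: "\<theta> \<ge> 1" and \<sigma>: "\<sigma> = real q - card S + card S * \<theta>"
  shows "nnz (partial_pow B S n t k) \<le> q ^ n + w ^ k * \<sigma> ^ n / \<theta> ^ t"
proof (induction n arbitrary: t k)
  case 0
  then show ?case using \<theta> by (simp add: nnz_one)
next
  case (Suc n)
  have "real (card S) * 1 \<le> card S * \<theta>" using \<theta> by (intro mult_left_mono) auto
  then have q\<sigma>: "real q \<le> \<sigma>" unfolding \<sigma> by simp
  let ?b = "w ^ k * \<sigma> ^ n / \<theta> ^ t"
  have b: "?b \<ge> 0" using q\<sigma> \<theta> by simp
  have "real (nnz (partial_pow B S (Suc n) t k)) \<le> real (\<Sum>a<q. if a \<in> S then
             if t = 0 \<and> k > 0 then Suc (e a) * nnz (partial_pow B S n 0 (k - 1))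
                              else nnz (partial_pow B S n (t - 1) k)
           else nnz (partial_pow B S n t k))"
    using nnz_partial_pow_Suc[of n t k] by (simp only: of_nat_le_iff)
  also have "\<dots> \<le> (\<Sum>a<q. if a \<in> S then q ^ n + \<theta> * ?b else q ^ n + ?b)"
    unfolding of_nat_sum
  proof (rule sum_mono)
    fix a
    consider "a \<notin> S" | "a \<in> S" "t = 0" "k > 0" | "a \<in> S" "t = 0" "k = 0" | "a \<in> S" "t > 0" by blast
    then show "real (if a \<in> S then
             if t = 0 \<and> k > 0 then Suc (e a) * nnz (partial_pow B S n 0 (k - 1))
                              else nnz (partial_pow B S n (t - 1) k)
           else nnz (partial_pow B S n t k)) \<le> (if a \<in> S then q ^ n + \<theta> * ?b else q ^ n + ?b)"
    proof cases
      case 1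
      then show ?thesis using Suc.IH[of t k] by simp
    next
      case 2
      have "Suc (e a) * nnz (partial_pow B S n 0 (k - 1)) \<le> w * (w ^ (k - 1) * q ^ n)"
        using w(1)[OF 2(1)] nnz_partial_pow_le by (intro mult_le_mono) auto
      also have "\<dots> = w ^ k * q ^ n"
        using 2 by (simp add: power_eq_if mult.assoc)
      finally have "real (Suc (e a) * nnz (partial_pow B S n 0 (k - 1))) \<le> real (w ^ k * q ^ n)"
        by (simp only: of_nat_le_iff)
      also have "\<dots> \<le> w ^ k * \<sigma> ^ n"
        using q\<sigma> by (simp add: mult_left_mono power_mono)
      also have "\<dots> = ?b" using 2 by simp
      also have "\<dots> \<le> \<theta> * ?b" using \<theta> b mult_right_mono[of 1 \<theta> ?b] by simp
      finally show ?thesis using 2 by (simp add: add_increasing)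
    next
      case 3
      then show ?thesis using b \<theta> by (simp add: partial_pow_zero nnz_one)
    next
      \<comment> \<open>Passing a letter from \<open>S\<close> lowers \<open>t\<close> by one, which
        the factor \<open>\<theta>\<close> pays for exactly.\<close>
      case 4
      then have "\<theta> * ?b = w ^ k * \<sigma> ^ n / \<theta> ^ (t - 1)"
        using \<theta> by (cases t) auto
      then show ?thesis using 4 Suc.IH[of "t - 1" k] by simp
    qed
  qed
  also have "\<dots> = card S * (q ^ n + \<theta> * ?b) + (real q - card S) * (q ^ n + ?b)"
    by (subst sum_if_S) simp
  also have "\<dots> = q * q ^ n + \<sigma> * ?b"
  proof -
    have "card S * (Q + \<theta> * b) + (real q - card S) * (Q + b) = q * Q + \<sigma> * b" for Q b :: real
      unfolding \<sigma> by (simp add: algebra_simps)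
    from this[of "real q ^ n" ?b] show ?thesis by simp
  qed
  also have "\<dots> = q ^ Suc n + w ^ k * \<sigma> ^ Suc n / \<theta> ^ t" by simp
  finally show ?case .
qed

text \<open>About \<open>d * n\<close> single-letter layers come first, then about
  \<open>n / r\<close> batches. The assumption \<open>less\<close> says that the tail ratio
  \<open>\<rho>\<close> is below 1, so a batch costs little more than one wire per row and all
  batches together about \<open>\<eta> * n\<close>.\<close>

lemma has_circuit_kron_pow_le:
  fixes \<theta> d \<eta> :: real
  assumes q: "q > 0" and \<theta>: "\<theta> \<ge> 1" and d: "d \<ge> 0" and \<eta>: "\<eta> > 0"
    and less: "real q - card S + card S * \<theta> < q * \<theta> powr d"
  shows "\<exists>K. \<forall>n. \<exists>s. has_circuit (q ^ n) (kron_pow B n) s \<and>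
    real s \<le> q ^ n * ((d + (\<Sum>a\<in>S. e a) / q + \<eta>) * n + K)"
proof -
  define \<sigma> where "\<sigma> = real q - card S + card S * \<theta>"
  define \<rho> where "\<rho> = \<sigma> / (q * \<theta> powr d)"
  define W where "W = real (\<Sum>a\<in>S. e a) / q"
  have "real (card S) * 1 \<le> card S * \<theta>" using \<theta> by (intro mult_left_mono) auto
  then have "\<sigma> > 0" using q unfolding \<sigma>_def by linarith
  have "\<theta> powr d > 0" using \<theta> by simp
  then have \<rho>: "0 \<le> \<rho>" "\<rho> < 1"
    using less q \<open>\<sigma> > 0\<close> by (simp_all add: \<rho>_def \<sigma>_def[symmetric])
  \<comment> \<open>The batch length depends on \<open>\<eta>\<close> alone, so \<open>w ^ r\<close>
    is a constant.\<close>
  obtain r' where "inverse (real (Suc r')) < \<eta>" using \<eta> reals_Archimedean by blast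
  define r where "r = Suc r'"
  have r: "r > 0" "1 / r \<le> \<eta>"
    using \<open>inverse (real (Suc r')) < \<eta>\<close> by (simp_all add: r_def inverse_eq_divide)
  \<comment> \<open>Up to linearly many batches each have an overhead proportional to
    \<open>\<rho> ^ n\<close>, so their total overhead per row stays bounded.\<close>
  have "(\<lambda>n. real n * \<rho> ^ n) \<longlonglongrightarrow> 0"
    using powser_times_n_limit_0[of \<rho>] \<rho> by simp
  then have "Bseq (\<lambda>n. real n * \<rho> ^ n)" by (intro convergent_imp_Bseq convergentI)
  then obtain c where "\<And>n. norm (real n * \<rho> ^ n) \<le> c" 
    unfolding Bseq_def by blast
  then have c: "real n * \<rho> ^ n \<le> c" for n using abs_le_D1 by auto
  show ?thesis
  proof (rule exI, rule allI)
    fix n :: nat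
    define D where "D = nat \<lceil>d * n\<rceil>"
    \<comment> \<open>Rounding up gives \<open>J * r \<ge> n\<close>, so the batches pass all
      letters that can remain.\<close>
    define J where "J = n div r + 1"
    have D: "d * n \<le> D" "D \<le> d * n + 1" 
    proof -
      have "0 \<le> \<lceil>d * n\<rceil>" using mult_nonneg_nonneg[of d n] d by linarith
      then have "real D = of_int \<lceil>d * n\<rceil>" by (simp add: D_def)
      then show "d * n \<le> D" "D \<le> d * n + 1" by linarith+
    qed
    have "real (n div r) * r \<le> n"
      unfolding of_nat_mult[symmetric] of_nat_le_iff by simp
    then have "real (n div r) \<le> n * (1 / r)" using r by (simp add: field_simps)
    also have "\<dots> \<le> n * \<eta>" using r by (intro mult_left_mono) auto
    finally have J: "real J \<le> \<eta> * n + 1" by (simp add: J_def mult.commute)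
    have "real J * \<rho> ^ n \<le> (real n + 1) * \<rho> ^ n"
      using \<rho> by (intro mult_right_mono) (auto simp: J_def)
    also have "\<dots> \<le> c + 1" using c[of n] power_le_one[of \<rho> n] \<rho> by (simp add: algebra_simps)
    finally have J\<rho>: "real J * \<rho> ^ n \<le> c + 1" .
    have nnz: "real (nnz (partial_pow B S n t r)) \<le> q ^ n * (1 + w ^ r * \<rho> ^ n)" if "t \<ge> D" for t
    proof -
      have "(\<theta> powr d) ^ n = \<theta> powr (d * n)"
        using \<theta> by (simp add: powr_powr[symmetric] powr_realpow)
      also have "\<dots> \<le> \<theta> powr real t" using \<theta> D that by (intro powr_mono) auto
      also have "\<dots> = \<theta> ^ t" using \<theta> by (simp add: powr_realpow)
      finally have "w ^ r * \<sigma> ^ n / \<theta> ^ t \<le> w ^ r * \<sigma> ^ n / (\<theta> powr d) ^ n"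
        using \<open>\<theta> powr d > 0\<close> \<open>\<sigma> > 0\<close> \<theta> by (intro divide_left_mono) auto
      also have "\<dots> = q ^ n * (w ^ r * \<rho> ^ n)"
        using q by (simp add: \<rho>_def power_divide power_mult_distrib)
      finally show ?thesis
        using nnz_partial_pow_tail_le[OF \<theta> \<sigma>_def, of n t r] by (simp add: distrib_left)
    qed
    obtain s where s: "s \<le> q ^ n + (\<Sum>t<D. nnz (partial_pow B S n t 1))"
      "has_circuit (q ^ n) (partial_pow B S n 0 D) s"
      using has_circuit_single_steps by blast
    have "real s \<le> q ^ n + (\<Sum>t<D. real (nnz (partial_pow B S n t 1)))"
      using s(1) by (simp only: of_nat_le_iff flip: of_nat_sum of_nat_add)
    also have "\<dots> \<le> q ^ n * (1 + D + n * W)"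
      using sum_nnz_partial_pow_le[OF q, of n D] by (simp add: W_def algebra_simps)
    finally have s_le: "real s \<le> q ^ n * (1 + D + n * W)" .
    obtain s' where s': "real s' \<le> s + J * (q ^ n * (1 + w ^ r * \<rho> ^ n))"
      "has_circuit (q ^ n) (partial_pow B S n 0 (D + J * r)) s'"
      using has_circuit_batches[OF s(2) nnz, of J] by blast
    have "n \<le> D + J * r"
      using dividend_less_times_div[OF r(1), of n] by (simp add: J_def mult.commute)
    then have circuit: "has_circuit (q ^ n) (kron_pow B n) s'"
      using s'(2) by (simp add: partial_pow_all)
    have "real s' \<le> q ^ n * (1 + D + n * W + (J + w ^ r * (J * \<rho> ^ n)))"
      using s'(1) s_le by (simp add: algebra_simps)
    also have "\<dots> \<le> q ^ n * (1 + (d * n + 1) + n * W + ((\<eta> * n + 1) + w ^ r * (c + 1)))"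
      using D J J\<rho> by (intro mult_left_mono add_mono) auto
    also have "\<dots> = q ^ n * ((d + W + \<eta>) * n + (3 + w ^ r * (c + 1)))"
      by (simp add: algebra_simps)
    finally show "\<exists>s. has_circuit (q ^ n) (kron_pow B n) s \<and>
        real s \<le> q ^ n * ((d + (\<Sum>a\<in>S. e a) / q + \<eta>) * n + (3 + w ^ r * (c + 1)))"
      using circuit unfolding W_def by blast
  qed
qed

end

end

section \<open>Two-by-two matrices\<close>

definition lower_tri :: "'a::semiring_1 \<Rightarrow> 'a \<Rightarrow> 'a \<Rightarrow> 'a mat" where
  "lower_tri y x z = mat_of_rows_list 2 [[y, 0], [x, z]]"

lemma lower_tri_carrier: "lower_tri y x z \<in> carrier_mat 2 2"
  by (auto simp: lower_tri_def mat_of_rows_list_def)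

text \<open>Splitting the square of a triangular matrix into two stages lets the last row of the square
  reuse the finished second row, at the price of three wires instead of four for two units of work.\<close>

definition stage1 :: "'a::semiring_1 \<Rightarrow> 'a \<Rightarrow> 'a mat" where
  "stage1 x z = mat_of_rows_list 4 [[1,0,0,0], [x,z,0,0], [0,0,1,0], [0,0,0,1]]"

definition stage2 :: "'a::semiring_1 \<Rightarrow> 'a \<Rightarrow> 'a \<Rightarrow> 'a mat" where
  "stage2 y x z = mat_of_rows_list 4 [[y*y,0,0,0], [0,y,0,0], [x*y,0,z*y,0], [0,x,z*x,z*z]]"

lemma stage_carrier: "stage1 x z \<in> carrier_mat 4 4" "stage2 y x z \<in> carrier_mat 4 4"
  by (auto simp: stage1_def stage2_def mat_of_rows_list_def)

lemma less_4_cases: "(i::nat) < 4 \<Longrightarrow> i = 0 \<or> i = 1 \<or> i = 2 \<or> i = 3"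
  by auto

text \<open>In the last row of the square, the first two entries \<open>x*x, x*z\<close> are
  \<open>x\<close> times the row \<open>x, z\<close> that \<open>stage1\<close> has already
  formed.\<close>

lemma kron_lower_tri:
  fixes x y z :: "'a::comm_semiring_1"
  shows "kron (lower_tri y x z) (lower_tri y x z) = stage2 y x z * stage1 x z"
proof (rule eq_matI)
  fix i j assume "i < dim_row (stage2 y x z * stage1 x z)" "j < dim_col (stage2 y x z * stage1 x z)"
  then have "i < 4" "j < 4" by (auto simp: stage1_def stage2_def mat_of_rows_list_def)
  note cases = this[THEN less_4_cases]
  have "(3::nat) div 2 = 1" "(3::nat) mod 2 = 1" by simp_all
  note three = this[unfolded numeral_3_eq_3 numeral_2_eq_2 One_nat_def]
  show "kron (lower_tri y x z) (lower_tri y x z) $$ (i, j) = (stage2 y x z * stage1 x z) $$ (i, j)"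
    using cases by - (elim disjE; simp add: kron_def lower_tri_def stage1_def stage2_def mat_of_rows_list_def
        scalar_prod_def sum.atLeast0_lessThan_Suc numeral_eq_Suc three ac_simps)
qed (auto simp: kron_def lower_tri_def stage1_def stage2_def mat_of_rows_list_def)

section \<open>Row counts of the stages, and circuits for triangular matrices\<close>

lemma row_nnz_le:
  assumes "finite T" "\<And>j. j < dim_col A \<Longrightarrow> A $$ (i,j) \<noteq> 0 \<Longrightarrow> j \<in> T" "card T \<le> k"
  shows "row_nnz A i \<le> k"
proof -
  have "row_nnz A i \<le> card T"
    unfolding row_nnz_def using assms(1,2) by (intro card_mono) auto
  then show ?thesis using assms(3) by simp
qed

lemma row_nnz_stage1:
  "row_nnz (stage1 x z) 0 \<le> 1" "row_nnz (stage1 x z) (Suc 0) \<le> 2"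
  "row_nnz (stage1 x z) 2 \<le> 1" "row_nnz (stage1 x z) 3 \<le> 1"
proof -
  show "row_nnz (stage1 x z) 0 \<le> 1"
    by (rule row_nnz_le[of "{0}"])
       (auto simp: stage1_def mat_of_rows_list_def dest!: less_4_cases)
  show "row_nnz (stage1 x z) (Suc 0) \<le> 2"
    by (rule row_nnz_le[of "{0,1}"])
       (auto simp: stage1_def mat_of_rows_list_def dest!: less_4_cases)
  show "row_nnz (stage1 x z) 2 \<le> 1"
    by (rule row_nnz_le[of "{2}"])
       (auto simp: stage1_def mat_of_rows_list_def dest!: less_4_cases)
  show "row_nnz (stage1 x z) 3 \<le> 1"
    by (rule row_nnz_le[of "{3}"])
       (auto simp: stage1_def mat_of_rows_list_def dest!: less_4_cases)
qed

lemma row_nnz_stage2: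
  "row_nnz (stage2 y x z) 0 \<le> 1" "row_nnz (stage2 y x z) (Suc 0) \<le> 1"
  "row_nnz (stage2 y x z) 2 \<le> 2" "row_nnz (stage2 y x z) 3 \<le> 3"
proof -
  show "row_nnz (stage2 y x z) 0 \<le> 1"
    by (rule row_nnz_le[of "{0}"])
       (auto simp: stage2_def mat_of_rows_list_def dest!: less_4_cases)
  show "row_nnz (stage2 y x z) (Suc 0) \<le> 1"
    by (rule row_nnz_le[of "{1}"])
       (auto simp: stage2_def mat_of_rows_list_def dest!: less_4_cases)
  show "row_nnz (stage2 y x z) 2 \<le> 2"
    by (rule row_nnz_le[of "{0,2}"])
       (auto simp: stage2_def mat_of_rows_list_def dest!: less_4_cases)
  show "row_nnz (stage2 y x z) 3 \<le> 3"
    by (rule row_nnz_le[of "{1,2,3}"])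
       (auto simp: stage2_def mat_of_rows_list_def dest!: less_4_cases)
qed

text \<open>Clears a rational exponent, leaving a comparison of integer powers that evaluation
  decides.\<close>

lemma less_powrI:
  fixes x y :: real
  assumes "0 < x" "0 < y" "u > 0" "x ^ u < y ^ v"
  shows "x < y powr (v / u)"
proof -
  have "x = (x ^ u) powr (1 / u)"
    using assms by (simp add: powr_realpow[symmetric] powr_powr)
  also have "\<dots> < (y ^ v) powr (1 / u)"
    using assms by (intro powr_less_mono2) auto
  also have "\<dots> = y powr (v / u)"
    using assms by (simp add: powr_realpow[symmetric] powr_powr)
  finally show ?thesis .
qed

text \<open>Per pair of positions the two stages cost \<open>0.512 + 1.262\<close> wires per row:
  layers, extra fan-in and slack.\<close>

lemma has_circuit_lower_tri_even:
  fixes x y z :: "'a::comm_semiring_1"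
  obtains K where "\<And>n. \<exists>s. has_circuit (4 ^ n) (kron_pow (lower_tri y x z) (2 * n)) s \<and>
    real s \<le> 4 ^ n * (1.774 * n + K)"
proof -
  \<comment> \<open>The letter 1 has density 1/4, and 0.26 lies just above it. With
    \<open>\<theta> = 21/20\<close> the mean of \<open>\<theta>\<close> over the four letters is
    \<open>(3 + 21/20) / 4 = 81/80\<close>.\<close>
  have "81 / 80 < (21 / 20 :: real) powr (real 26 / real 100)"
    by (rule less_powrI) (simp_all add: power_divide)
  then have less1: "real 4 - card {1::nat} + card {1::nat} * (21/20) < real 4 * (21/20) powr 0.26"
    by simp
  \<comment> \<open>The letters 2 and 3 have density 1/2, and 0.51 lies just above it. Here
    \<open>\<theta> = 103/100\<close> gives the mean
    \<open>(2 + 2 * 103/100) / 4 = 203/200\<close>.\<close>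
  have "203 / 200 < (103 / 100 :: real) powr (real 51 / real 100)"
    by (rule less_powrI) (simp_all add: power_divide)
  then have less2: "real 4 - card {2, 3::nat} + card {2, 3::nat} * (103/100)
      < real 4 * (103/100) powr 0.51"
    by simp
  have light1: "row_nnz (stage1 x z) a \<le> 1" if "a < 4" "a \<notin> {1}" for a
    using less_4_cases[OF that(1)] that(2) row_nnz_stage1[of x z] by auto
  have light2: "row_nnz (stage2 y x z) a \<le> 1" if "a < 4" "a \<notin> {2, 3}" for a
    using less_4_cases[OF that(1)] that(2) row_nnz_stage2[of y x z] by auto
  have "\<exists>K. \<forall>n. \<exists>s. has_circuit (4 ^ n) (kron_pow (stage1 x z) n) s \<and>
      real s \<le> (4 ^ n :: nat) * ((0.26 + (\<Sum>a\<in>{1::nat}. 1::nat) / (4::nat) + 0.002) * n + K)"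
    by (rule has_circuit_kron_pow_le[OF stage_carrier(1) _ light1 _ _ _ _ _ _ _ less1, where w = 2])
       (use row_nnz_stage1(2)[of x z] in \<open>simp_all add: numeral_2_eq_2\<close>)
  then obtain K1 where K1: "\<And>n. \<exists>s. has_circuit (4 ^ n) (kron_pow (stage1 x z) n) s \<and>
      real s \<le> 4 ^ n * (0.512 * n + K1)"
    by auto
  \<comment> \<open>Rows 2 and 3 have at most two and three entries, so \<open>e a = a - 1\<close>
    counts 1 and 2 extra wires, on average 3/4.\<close>
  have "\<exists>K. \<forall>n. \<exists>s. has_circuit (4 ^ n) (kron_pow (stage2 y x z) n) s \<and>
      real s \<le> (4 ^ n :: nat) * ((0.51 + (\<Sum>a\<in>{2,3::nat}. a - 1) / (4::nat) + 0.002) * n + K)"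
    by (rule has_circuit_kron_pow_le[OF stage_carrier(2) _ light2 _ _ _ _ _ _ _ less2, where w = 3])
       (use row_nnz_stage2(3,4)[of y x z] in auto)
  then obtain K2 where K2: "\<And>n. \<exists>s. has_circuit (4 ^ n) (kron_pow (stage2 y x z) n) s \<and>
      real s \<le> 4 ^ n * (1.262 * n + K2)"
    by auto
  show ?thesis
  proof (rule that)
    fix n
    obtain s1 where s1: "has_circuit (4 ^ n) (kron_pow (stage1 x z) n) s1"
      "real s1 \<le> 4 ^ n * (0.512 * n + K1)"
      using K1 by blast
    obtain s2 where s2: "has_circuit (4 ^ n) (kron_pow (stage2 y x z) n) s2"
      "real s2 \<le> 4 ^ n * (1.262 * n + K2)"
      using K2 by blast
    have "kron_pow (lower_tri y x z) (2 * n) = kron_pow (stage2 y x z) n * kron_pow (stage1 x z) n"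
      by (simp add: kron_pow_double kron_lower_tri kron_pow_mult[of _ 4] stage_carrier)
    then have "has_circuit (4 ^ n) (kron_pow (lower_tri y x z) (2 * n)) (s2 + s1)"
      using has_circuit.mult[OF s2(1) s1(1)] by simp
    moreover have "real (s2 + s1) \<le> 4 ^ n * (1.774 * n + (K1 + K2))"
      using s1(2) s2(2) by (simp add: algebra_simps)
    ultimately show "\<exists>s. has_circuit (4 ^ n) (kron_pow (lower_tri y x z) (2 * n)) s \<and>
        real s \<le> 4 ^ n * (1.774 * n + (K1 + K2))" by blast
  qed
qed

lemma nnz_le_dims: "A \<in> carrier_mat p q \<Longrightarrow> nnz A \<le> p * q"
proof -
  assume A: "A \<in> carrier_mat p q"
  have "row_nnz A i \<le> q" for i
    by (rule row_nnz_le[of "{..<q}"]) (use A in auto)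
  then show ?thesis
    using A sum_mono[of "{..<p}" "row_nnz A" "\<lambda>_. q"] by (simp add: nnz_eq_sum_row_nnz)
qed

text \<open>Even \<open>n\<close> is the paired bound with half the constant. For odd
  \<open>n\<close> one factor is split off, at a cost absorbed by the additive constant.\<close>

lemma has_circuit_lower_tri:
  fixes x y z :: "'a::comm_semiring_1"
  obtains K where "\<And>n. \<exists>s. has_circuit (2 ^ n) (kron_pow (lower_tri y x z) n) s \<and>
    real s \<le> 2 ^ n * (0.887 * n + K)"
proof -
  let ?L = "lower_tri y x z"
  obtain K where K: "\<And>n. \<exists>s. has_circuit (4 ^ n) (kron_pow ?L (2 * n)) s \<and>
    real s \<le> 4 ^ n * (1.774 * n + K)"
    using has_circuit_lower_tri_even[of y x z] by blast
  have "\<exists>s. has_circuit (2 ^ n) (kron_pow ?L n) s \<and> real s \<le> 2 ^ n * (0.887 * n + (K + 2))" for n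
  proof (cases "even n")
    case True
    then obtain m where n: "n = 2 * m" by blast
    obtain s where s: "has_circuit (4 ^ m) (kron_pow ?L (2 * m)) s"
      "real s \<le> 4 ^ m * (1.774 * m + K)" using K by blast
    have "4 ^ m = (2 ^ n :: nat)" "4 ^ m = (2 ^ n :: real)" by (simp_all add: n power_mult)
    with s have "has_circuit (2 ^ n) (kron_pow ?L n) s" "real s \<le> 2 ^ n * (0.887 * n + K)"
      by (simp_all add: n)
    then show ?thesis
      by (intro exI[of _ s]) (auto intro: order_trans)
  next
    case False
    then obtain m where n: "n = Suc (2 * m)" using oddE by fastforce
    obtain s where s: "has_circuit (4 ^ m) (kron_pow ?L (2 * m)) s"
      "real s \<le> 4 ^ m * (1.774 * m + K)" using K by blast
    have X: "kron_pow ?L (2 * m) \<in> carrier_mat (4 ^ m) (4 ^ m)"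
      using s(1) by (rule has_circuit_carrier)
    obtain t where t: "has_circuit (2 * 4 ^ m) (kron (1\<^sub>m 2) (kron_pow ?L (2 * m))) t" "t \<le> 2 * s"
      using has_circuit_kron_one[OF s(1)] by blast
    let ?A = "kron ?L (1\<^sub>m (4 ^ m))"
    \<comment> \<open>The split-off factor acts in one layer of at most \<open>4 * 4 ^ m\<close>
      wires, which is 2 per row; the rest is two parallel copies of the even circuit.\<close>
    have "kron_pow ?L n = ?A * kron (1\<^sub>m 2) (kron_pow ?L (2 * m))"
      using kron_mult_kron[OF lower_tri_carrier one_carrier_mat one_carrier_mat X]
        X lower_tri_carrier[of y x z] by (simp add: n)
    moreover have "has_circuit (2 * 4 ^ m) ?A (nnz ?A)"
      using lower_tri_carrier by (intro has_circuit.layer kron_carrier) auto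
    moreover have N: "2 * 4 ^ m = (2 ^ n :: nat)" "2 * 4 ^ m = (2 ^ n :: real)"
      by (simp_all add: n power_mult)
    ultimately have "has_circuit (2 ^ n) (kron_pow ?L n) (nnz ?A + t)"
      using has_circuit.mult[OF _ t(1)] by metis
    moreover have "real (nnz ?A + t) \<le> 2 ^ n * (0.887 * n + (K + 2))"
    proof -
      have "nnz ?A \<le> nnz ?L * 4 ^ m"
        using nnz_kron_le[OF one_carrier_mat] by (metis nnz_one)
      also have "\<dots> \<le> 4 * 4 ^ m"
        using nnz_le_dims[OF lower_tri_carrier[of y x z]] by simp
      finally have "real (nnz ?A) \<le> real (4 * 4 ^ m)" by (simp only: of_nat_le_iff)
      moreover have "real t \<le> 2 * (4 ^ m * (1.774 * m + K))"
        using t(2) s(2) by linarith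
      ultimately have "real (nnz ?A + t) \<le> 2 * 4 ^ m * (2 + (1.774 * m + K))"
        by (simp add: algebra_simps)
      also have "\<dots> \<le> 2 * 4 ^ m * (0.887 * n + (K + 2))"
        by (intro mult_left_mono) (auto simp: n)
      finally show ?thesis unfolding N .
    qed
    ultimately show ?thesis by blast
  qed
  then show ?thesis using that by blast
qed

section \<open>Reduction of an arbitrary matrix to triangular factors\<close>

lemma mat_2_2_eqI:
  assumes "A \<in> carrier_mat 2 2" "A' \<in> carrier_mat 2 2"
    "A $$ (0,0) = A' $$ (0,0)" "A $$ (0,1) = A' $$ (0,1)" "A $$ (1,0) = A' $$ (1,0)" "A $$ (1,1) = A' $$ (1,1)"
  shows "A = A'"
  using assms by (intro eq_matI) (auto simp: less_2_cases_iff)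

text \<open>Elimination when the corner entry is nonzero, a row swap when only the entry below it
  is, and nothing to eliminate when the first column vanishes. Diagonal entries of the upper factor
  may be 0, so singular matrices are covered.\<close>

lemma PLU_decomposition:
  fixes M :: "'a::field mat"
  assumes M: "M \<in> carrier_mat 2 2"
  obtains P x a b d where "P \<in> carrier_mat 2 2" "nnz P \<le> 2"
    "M = P * (lower_tri 1 x 1 * transpose_mat (lower_tri a b d))"
proof -
  note ms = lower_tri_def mat_of_rows_list_def scalar_prod_def sum.atLeast0_lessThan_Suc numeral_2_eq_2
  consider "M $$ (0,0) \<noteq> 0" | "M $$ (0,0) = 0" "M $$ (1,0) = 0" | "M $$ (0,0) = 0" "M $$ (1,0) \<noteq> 0"
    by blast
  then show ?thesis
  proof cases
    case 1
    have "M = 1\<^sub>m 2 * (lower_tri 1 (M $$ (1,0) / M $$ (0,0)) 1 * transpose_mat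
        (lower_tri (M $$ (0,0)) (M $$ (0,1)) (M $$ (1,1) - M $$ (1,0) / M $$ (0,0) * M $$ (0,1))))"
      by (rule mat_2_2_eqI[OF M]) (use M 1 in \<open>auto simp: ms\<close>)
    then show ?thesis by (rule that[rotated 2]) (auto simp: nnz_one)
  next
    case 2
    have "M = 1\<^sub>m 2 * (lower_tri 1 0 1 * transpose_mat (lower_tri 0 (M $$ (0,1)) (M $$ (1,1))))"
      by (rule mat_2_2_eqI[OF M]) (use M 2 in \<open>auto simp: ms\<close>)
    then show ?thesis by (rule that[rotated 2]) (auto simp: nnz_one)
  next
    case 3
    let ?P = "mat_of_rows_list 2 [[0, 1], [1, 0]] :: 'a mat"
    have "row_nnz ?P 0 \<le> 1"
      by (rule row_nnz_le[of "{1}"]) (auto simp: mat_of_rows_list_def less_2_cases_iff)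
    moreover have "row_nnz ?P 1 \<le> 1"
      by (rule row_nnz_le[of "{0}"]) (auto simp: mat_of_rows_list_def less_2_cases_iff)
    ultimately have "nnz ?P \<le> 2" by (simp add: nnz_eq_sum_row_nnz mat_of_rows_list_def numeral_2_eq_2)
    moreover have "M = ?P * (lower_tri 1 0 1 * transpose_mat
        (lower_tri (M $$ (1,0)) (M $$ (1,1)) (M $$ (0,1))))"
      by (rule mat_2_2_eqI[OF M]) (use M 3 in \<open>auto simp: ms\<close>)
    ultimately show ?thesis
      by (intro that[of ?P]) (auto simp: mat_of_rows_list_def)
  qed
qed

text \<open>Both triangular factors contribute 0.887, the upper one through its transpose. As
  \<open>nnz P \<le> 2\<close>, the power of \<open>P\<close> is one layer of at most
  \<open>2 ^ n\<close> wires, which only affects \<open>K\<close>.\<close>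

lemma has_circuit_kron_pow_2:
  fixes M :: "'a::field mat"
  assumes M: "M \<in> carrier_mat 2 2"
  obtains K where "\<And>n. \<exists>s. has_circuit (2 ^ n) (kron_pow M n) s \<and> real s \<le> 2 ^ n * (1.774 * n + K)"
proof -
  obtain P x a b d where P: "P \<in> carrier_mat 2 2" "nnz P \<le> 2"
    and M_eq: "M = P * (lower_tri 1 x 1 * transpose_mat (lower_tri a b d))"
    using PLU_decomposition[OF M] by blast
  obtain K1 where K1: "\<And>n. \<exists>s. has_circuit (2 ^ n) (kron_pow (lower_tri 1 x 1) n) s \<and>
    real s \<le> 2 ^ n * (0.887 * n + K1)" using has_circuit_lower_tri[of 1 x 1] by blast
  obtain K2 where K2: "\<And>n. \<exists>s. has_circuit (2 ^ n) (kron_pow (lower_tri a b d) n) s \<and>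
    real s \<le> 2 ^ n * (0.887 * n + K2)" using has_circuit_lower_tri[of a b d] by blast
  have L: "lower_tri 1 x 1 \<in> carrier_mat 2 2"
    and L': "transpose_mat (lower_tri a b d) \<in> carrier_mat 2 2"
    by (simp_all add: lower_tri_carrier)
  show ?thesis
  proof (rule that)
    fix n
    obtain s1 where s1: "has_circuit (2 ^ n) (kron_pow (lower_tri 1 x 1) n) s1"
      "real s1 \<le> 2 ^ n * (0.887 * n + K1)" using K1 by blast
    obtain s2 where s2: "has_circuit (2 ^ n) (kron_pow (lower_tri a b d) n) s2"
      "real s2 \<le> 2 ^ n * (0.887 * n + K2)" using K2 by blast
    have "has_circuit (2 ^ n) (kron_pow (transpose_mat (lower_tri a b d)) n) s2"
      using has_circuit_transpose[OF s2(1)] by (simp add: transpose_kron_pow)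
    moreover have "kron_pow M n = kron_pow P n *
        (kron_pow (lower_tri 1 x 1) n * kron_pow (transpose_mat (lower_tri a b d)) n)"
      unfolding M_eq kron_pow_mult[OF P(1) mult_carrier_mat[OF L L']] kron_pow_mult[OF L L'] ..
    ultimately have circuit: "has_circuit (2 ^ n) (kron_pow M n) (nnz (kron_pow P n) + (s1 + s2))"
      using has_circuit.mult[OF has_circuit.layer[OF kron_pow_carrier[OF P(1)]] has_circuit.mult[OF s1(1)]]
      by simp
    have "nnz (kron_pow P n) \<le> 2 ^ n"
      using nnz_kron_pow_le[OF P(1), of n] power_mono[OF P(2), of n] by simp
    then have "real (nnz (kron_pow P n)) \<le> real (2 ^ n)" by (simp only: of_nat_le_iff)
    then have "real (nnz (kron_pow P n)) \<le> 2 ^ n" by (simp only: of_nat_power of_nat_numeral)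
    then have "real (nnz (kron_pow P n) + (s1 + s2)) \<le>
        2 ^ n + (2 ^ n * (0.887 * n + K1) + 2 ^ n * (0.887 * n + K2))"
      unfolding of_nat_add using s1(2) s2(2) by (intro add_mono)
    also have "\<dots> = 2 ^ n * (1.774 * n + (1 + K1 + K2))"
      by (simp add: algebra_simps)
    finally have "real (nnz (kron_pow P n) + (s1 + s2)) \<le> 2 ^ n * (1.774 * n + (1 + K1 + K2))" .
    with circuit show "\<exists>s. has_circuit (2 ^ n) (kron_pow M n) s \<and>
        real s \<le> 2 ^ n * (1.774 * n + (1 + K1 + K2))" by blast
  qed
qed

section \<open>The numerical constant and the conclusion\<close>

lemma exp_1_times_ln_2_lower: "1.774 \<le> (1 - 0.0482) * exp 1 * ln (2::real)"
proof -
  \<comment> \<open>\<open>145 / 128\<close> is \<open>1 + 1/8 + 1/128\<close>, the quadratic Taylor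
    bound for \<open>exp (1 / 8)\<close>.\<close>
  have "(2.71::real) \<le> (145 / 128) ^ 8" by (simp add: power_divide)
  also have "\<dots> \<le> exp (1 / 8) ^ 8"
    using exp_lower_Taylor_quadratic[of "1 / 8"] by (intro power_mono) (simp_all add: power2_eq_square)
  also have "\<dots> = exp (1::real)" by (simp flip: exp_of_nat_mult)
  finally have e: "2.71 \<le> exp (1::real)" .
  \<comment> \<open>For \<open>ln 2 \<ge> 0.69\<close> it suffices that
    \<open>exp (- 0.69) \<ge> 1 / 2\<close>, and \<open>0.69 = 138 / 200\<close>.\<close>
  have "199 / 200 \<le> exp (- 1 / 200 :: real)" using exp_ge_add_one_self[of "- 1 / 200 :: real"] by simp
  then have "(199 / 200) ^ 138 \<le> exp (- 1 / 200 :: real) ^ 138" by (intro power_mono) auto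
  also have "\<dots> = exp (- 0.69)" by (simp flip: exp_of_nat_mult)
  finally have "(199 / 200) ^ 138 \<le> exp (- 0.69 :: real)" .
  moreover have "1 / 2 \<le> (199 / 200 :: real) ^ 138" by (simp add: power_divide)
  ultimately have "1 / 2 \<le> exp (- 0.69 :: real)" by linarith
  then have "exp 0.69 \<le> (2::real)" by (simp add: exp_minus field_simps)
  then have "0.69 \<le> ln (2::real)" by (subst ln_ge_iff) auto
  with e have "2.71 * 0.69 \<le> exp 1 * ln (2::real)" by (intro mult_mono) auto
  then show ?thesis by simp
qed

theorem theorem1p5:
  shows "(\<forall>M :: 'a::field mat. M \<in> carrier_mat 2 2 \<longrightarrow>
     (\<exists>\<epsilon>::real. \<epsilon> > 0.01526 \<and>
       (\<exists>g :: nat \<Rightarrow> real. g \<longlonglongrightarrow> 0 \<and>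
         (\<forall>n::nat. n \<ge> 1 \<longrightarrow>
           (\<exists>As. sync_circuit (kron_pow M n) As \<and>
              real (circuit_size As) \<le> ((1 - \<epsilon>) * exp 1 * ln 2 + g n) * 2 ^ n * log 2 (2 ^ n))))))
   \<and> (\<exists>\<epsilon>::real. \<epsilon> > 0.04816 \<and>
       (\<exists>g :: nat \<Rightarrow> real. g \<longlonglongrightarrow> 0 \<and>
         (\<forall>n::nat. n \<ge> 1 \<longrightarrow>
           (\<exists>As. sync_circuit (kron_pow (H1 :: 'a mat) n) As \<and>
              real (circuit_size As) \<le> ((1 - \<epsilon>) * exp 1 * ln 2 + g n) * 2 ^ n * log 2 (2 ^ n)))))"
proof -
  \<comment> \<open>A single constant serves both claims: 0.0482 exceeds 0.01526 and
    0.04816.\<close>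
  let ?c = "(1 - 0.0482) * exp 1 * ln (2::real)"
  have main: "\<exists>g :: nat \<Rightarrow> real. g \<longlonglongrightarrow> 0 \<and> (\<forall>n::nat. n \<ge> 1 \<longrightarrow>
      (\<exists>As. sync_circuit (kron_pow M n) As \<and>
        real (circuit_size As) \<le> (?c + g n) * 2 ^ n * log 2 (2 ^ n)))"
    if M: "M \<in> carrier_mat 2 2" for M :: "'a mat"
  proof -
    obtain K where K: "\<And>n. \<exists>s. has_circuit (2 ^ n) (kron_pow M n) s \<and>
      real s \<le> 2 ^ n * (1.774 * n + K)"
      using has_circuit_kron_pow_2[OF M] by blast
    \<comment> \<open>The additive \<open>K\<close> per row, divided by
      \<open>log 2 (2 ^ n) = n\<close>, becomes the vanishing term \<open>K / n\<close>.\<close>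
    have "\<exists>As. sync_circuit (kron_pow M n) As \<and>
        real (circuit_size As) \<le> (?c + K / n) * 2 ^ n * log 2 (2 ^ n)" if n: "n \<ge> 1" for n :: nat
    proof -
      obtain s where s: "has_circuit (2 ^ n) (kron_pow M n) s" "real s \<le> 2 ^ n * (1.774 * n + K)"
        using K by blast
      obtain As where As: "sync_circuit (kron_pow M n) As" "circuit_size As = s"
        using has_circuit_imp_sync_circuit[OF s(1)] .
      note s(2)
      also have "2 ^ n * (1.774 * n + K) \<le> 2 ^ n * (?c * n + K)"
        using exp_1_times_ln_2_lower by (intro mult_left_mono add_right_mono mult_right_mono) auto
      also have "\<dots> = (?c + K / n) * 2 ^ n * n"
        using n by (simp add: algebra_simps)
      also have "real n = log 2 (2 ^ n)" by simp
      finally show ?thesis using As by auto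
    qed
    moreover have "(\<lambda>n. K / real n) \<longlonglongrightarrow> 0" by (rule lim_const_over_n)
    ultimately show ?thesis by blast
  qed
  moreover have "(H1 :: 'a mat) \<in> carrier_mat 2 2"
    by (auto simp: H1_def mat_of_rows_list_def)
  ultimately show ?thesis
    by (intro conjI allI impI exI[of _ "0.0482::real"]) auto
qed

end
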